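(* Let $q=4n+1$ be a prime with $n\ge 3$, and let $r=q+1$. Let $S,T,u_0,u_1,H_1,H_2,G_1,G_2$ be the sets, integers and graphs specified in the context. Then the amalgam graph $B^*_q(S,T,u_0,u_1)$ is an $(\{r,2r-5\};5)$-cage of order $r(2r-5)+1$.
   Context: All graphs are finite, undirected and simple. The girth of a graph is the length of a shortest cycle. For integers $2\le r<m$, an $(\{r,m\};g)$-graph is a graph of girth exactly $g$ whose set of vertex degrees is exactly $\{r,m\}$, and an $(\{r,m\};g)$-cage is an $(\{r,m\};g)$-graph of minimum possible order. Here $GF(q)=\mathbb Z_q$ (integers mod $q$), $\mathbb Z_q^*=\mathbb Z_q\setminus\{0\}$, and $\alpha$ is a fixed generator of the multiplicative group $\mathbb Z_q^*$. The graph $B_q$ is the bipartite graph with vertex classes $V_0=\{(x,y)_0: x,y\in\mathbb Z_q\}$ and $V_1=\{(m,b)_1: m,b\in\mathbb Z_q\}$, in which $(x,y)_0$ is adjacent to $(m,b)_1$ if and only if $y=mx+b$. For $x,m\in \mathbb Z_q$ put $P_x=\{(x,y)_0: y\in\mathbb Z_q\}$ and $L_m=\{(m,b)_1: b\in\mathbb Z_q\}$. General construction. For $T\subseteq S\subseteq\mathbb Z_q$ and integers $0\le u_0\le u_1<q-1$, let $U_i=\{\alpha^{q-j}: j=2,\dots,u_i+1\}$ for $i=0,1$ (empty if $u_i=0$). The graph $B_q(S,T,u_0,u_1)$ is obtained from $B_q$ by deleting the vertices $(0,y)_0$ with $y\in S$, the vertices $(0,b)_1$ with $b\in T$, all blocks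 $P_x$ with $x\in U_0$, and all blocks $L_m$ with $m\in U_1$. Given graphs $H_1,H_2,G_1,G_2$ with vertex sets $\mathbb Z_q\setminus S$, $\mathbb Z_q\setminus T$, $\mathbb Z_q$, $\mathbb Z_q$ respectively, the amalgam $B^*_q(S,T,u_0,u_1)$ is obtained from $B_q(S,T,u_0,u_1)$ by adding the edges: $(0,u)_0(0,v)_0$ for $uv\in E(H_1)$; $(0,u)_1(0,v)_1$ for $uv\in E(H_2)$; $(x,u)_0(x,v)_0$ for $x\in\mathbb Z_q^*\setminus U_0$ and $uv\in E(G_1)$; $(m,u)_1(m,v)_1$ for $m\in\mathbb Z_q^*\setminus U_1$ and $uv\in E(G_2)$. Choice of parameters ($q\equiv 1 \bmod 4$; all elements and sums are taken modulo $q$): $S=\{\frac{q-1}{4},\frac{3q+1}{4}\}$, $T=\emptyset$, $u_0=0$, $u_1=1$ (so $U_0=\emptyset$, $U_1=\{\alpha^{q-2}\}$). $H_1$ has vertex set $\mathbb Z_q\setminus\{\frac{q-1}{4},\frac{3q+1}{4}\}$ and edges $\{j,j+\frac{q-1}{2}\}$ for $j\in\mathbb Z_q\setminus\{\frac{q-1}{4},\frac{3q+1}{4},\frac{q+3}{4}\}$ together with $\{\frac{3q-3}{4},\frac{q+3}{4}\}$ (a $(q-2)$-cycle). $G_1$ has vertex set $\mathbb Z_q$ and edges $\{j,j+\frac{q-1}{2}\}$ for $j\in\mathbb Z_q$ (a $q$-cycle). $H_2$ and $G_2$ are both the graph with vertex set $\mathbb Z_q$ and edges $\{0,j\}$ for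 $j\in\mathbb Z_q^*\setminus\{\frac{q-1}{2},\frac{q+1}{2}\}$ together with $\{\frac{q-1}{4},\frac{q-1}{2}\}$ and $\{\frac{3q+1}{4},\frac{q+1}{2}\}$. *)

theory Defs
  imports "HOL-Number_Theory.Number_Theory" "HOL-Library.Extended_Nat"
begin

datatype 'a graph = Graph (verts: "'a set") (edges: "'a set set")

definition simple_graph :: "'a graph \<Rightarrow> bool" where
  "simple_graph G \<longleftrightarrow> finite (verts G) \<and> (\<forall>e\<in>edges G. e \<subseteq> verts G \<and> card e = 2)"

definition graph_order :: "'a graph \<Rightarrow> nat" where
  "graph_order G = card (verts G)"

definition graph_degree :: "'a graph \<Rightarrow> 'a \<Rightarrow> nat" where
  "graph_degree G v = card {e \<in> edges G. v \<in> e}"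

definition is_cycle :: "'a graph \<Rightarrow> 'a list \<Rightarrow> bool" where
  "is_cycle G c \<longleftrightarrow> length c \<ge> 3 \<and> distinct c \<and> set c \<subseteq> verts G \<and>
     (\<forall>i < length c. {c ! i, c ! (Suc i mod length c)} \<in> edges G)"

text \<open>Extended naturals, so that an acyclic graph has girth \<open>\<infinity>\<close>.\<close>

definition girth :: "'a graph \<Rightarrow> enat" where
  "girth G = Inf {enat (length c) | c. is_cycle G c}"

definition biregular_graph :: "nat \<Rightarrow> nat \<Rightarrow> nat \<Rightarrow> 'a graph \<Rightarrow> bool" where
  "biregular_graph r m g G \<longleftrightarrow>
     2 \<le> r \<and> r < m \<and> simple_graph G \<and> girth G = enat g \<and> graph_degree G ` verts G = {r, m}"

text \<open>A definition cannot quantify over vertex types. Since every finite graph is isomorphic to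
  one whose vertices are natural numbers, minimality is stated against those; the lemma
  \<open>biregular_cage_minimal\<close> below recovers minimality over an arbitrary vertex type.\<close>

definition biregular_cage :: "nat \<Rightarrow> nat \<Rightarrow> nat \<Rightarrow> 'a graph \<Rightarrow> bool" where
  "biregular_cage r m g G \<longleftrightarrow> biregular_graph r m g G \<and>
     (\<forall>H :: nat graph. biregular_graph r m g H \<longrightarrow> graph_order G \<le> graph_order H)"

definition map_verts :: "('a \<Rightarrow> 'b) \<Rightarrow> 'a graph \<Rightarrow> 'b graph" where
  "map_verts f G = Graph (f ` verts G) ((`) f ` edges G)"

lemma is_cycle_map_verts:
  assumes "inj_on f (verts G)" "is_cycle G c"
  shows "is_cycle (map_verts f G) (map f c)"
  unfolding is_cycle_def
proof (intro conjI allI impI)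
  show "length (map f c) \<ge> 3" using assms by (simp add: is_cycle_def)
  show "distinct (map f c)"
    using assms by (auto simp: is_cycle_def distinct_map intro: inj_on_subset)
  show "set (map f c) \<subseteq> verts (map_verts f G)"
    using assms by (auto simp: is_cycle_def map_verts_def)
  fix i assume i: "i < length (map f c)"
  let ?j = "Suc i mod length c"
  have j: "?j < length c" using i by (metis length_map mod_less_divisor length_greater_0_conv
        less_nat_zero_code list.size(3))
  have "{c ! i, c ! ?j} \<in> edges G" using assms i by (auto simp: is_cycle_def)
  hence "f ` {c ! i, c ! ?j} \<in> edges (map_verts f G)"
    unfolding map_verts_def by (metis graph.sel(2) imageI)
  thus "{map f c ! i, map f c ! (Suc i mod length (map f c))} \<in> edges (map_verts f G)"
    using i j by simp
qed

lemma map_verts_inverse: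
  assumes "simple_graph G" "inj_on f (verts G)"
  shows "map_verts (inv_into (verts G) f) (map_verts f G) = G"
proof (rule graph.expand, intro conjI)
  let ?g = "inv_into (verts G) f"
  show "verts (map_verts ?g (map_verts f G)) = verts G"
    using assms(2) by (simp add: map_verts_def)
  have "?g ` f ` e = e" if "e \<in> edges G" for e
    using that assms by (auto simp: simple_graph_def inv_into_image_cancel)
  thus "edges (map_verts ?g (map_verts f G)) = edges G"
    by (simp add: map_verts_def image_image cong: image_cong)
qed

lemma girth_map_verts:
  assumes "simple_graph G" "inj_on f (verts G)"
  shows "girth (map_verts f G) = girth G"
proof -
  let ?g = "inv_into (verts G) f"
  have inj: "inj_on ?g (verts (map_verts f G))"
    by (simp add: map_verts_def inj_on_inv_into)
  have "{enat (length c) | c. is_cycle (map_verts f G) c} = {enat (length c) | c. is_cycle G c}"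
    (is "?A = ?B")
  proof
    show "?A \<subseteq> ?B"
      using is_cycle_map_verts[OF inj] unfolding map_verts_inverse[OF assms]
      by (smt (verit) Collect_mono length_map)
    show "?B \<subseteq> ?A"
      using is_cycle_map_verts[OF assms(2)] by (smt (verit) Collect_mono length_map)
  qed
  thus ?thesis by (simp add: girth_def)
qed

lemma degree_map_verts:
  assumes "simple_graph G" "inj_on f (verts G)" "v \<in> verts G"
  shows "graph_degree (map_verts f G) (f v) = graph_degree G v"
proof -
  have sub: "e \<subseteq> verts G" if "e \<in> edges G" for e
    using that assms(1) by (simp add: simple_graph_def)
  have "{e \<in> edges (map_verts f G). f v \<in> e} = (`) f ` {e \<in> edges G. v \<in> e}"
    using inj_on_image_mem_iff[OF assms(2,3) sub] by (auto simp: map_verts_def)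
  moreover have "inj_on ((`) f) {e \<in> edges G. v \<in> e}"
    by (rule inj_on_subset[OF inj_on_image_Pow[OF assms(2)]]) (use sub in auto)
  ultimately show ?thesis by (simp add: graph_degree_def card_image)
qed

lemma biregular_graph_map_verts:
  assumes "biregular_graph r m g G" "inj_on f (verts G)"
  shows "biregular_graph r m g (map_verts f G)"
proof -
  have G: "simple_graph G" using assms(1) by (simp add: biregular_graph_def)
  have "card (f ` e) = 2 \<and> f ` e \<subseteq> f ` verts G" if "e \<in> edges G" for e
    using that G assms(2) by (metis card_image image_mono inj_on_subset simple_graph_def)
  hence "simple_graph (map_verts f G)"
    using G by (auto simp: simple_graph_def map_verts_def)
  moreover have "graph_degree (map_verts f G) ` verts (map_verts f G) = graph_degree G ` verts G"
    using degree_map_verts[OF G assms(2)] by (force simp: map_verts_def image_image)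
  ultimately show ?thesis
    using assms girth_map_verts[OF G assms(2)] by (simp add: biregular_graph_def)
qed

lemma biregular_cage_minimal:
  fixes H :: "'b graph"
  assumes "biregular_cage r m g G" "biregular_graph r m g H"
  shows "graph_order G \<le> graph_order H"
proof -
  have "finite (verts H)" using assms(2) by (simp add: biregular_graph_def simple_graph_def)
  then obtain f :: "'b \<Rightarrow> nat" where f: "inj_on f (verts H)"
    using finite_imp_inj_to_nat_seg by blast
  have "graph_order G \<le> graph_order (map_verts f H)"
    using assms(1) biregular_graph_map_verts[OF assms(2) f] unfolding biregular_cage_def by blast
  also have "\<dots> = graph_order H" using f by (simp add: graph_order_def map_verts_def card_image)
  finally show ?thesis .
qed

text \<open>\<open>\<int>\<^sub>q\<close> is represented by \<open>{0..<q}\<close> with all arithmetic reduced modulo \<open>q\<close>;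
  \<open>Pt x y\<close> and \<open>Ln m b\<close> stand for \<open>(x, y)\<^sub>0\<close> and \<open>(m, b)\<^sub>1\<close>.\<close>

definition Zmod :: "nat \<Rightarrow> nat set" where
  "Zmod q = {0..<q}"

datatype vertex = Pt nat nat | Ln nat nat

definition P_block :: "nat \<Rightarrow> nat \<Rightarrow> vertex set" where
  "P_block q x = {Pt x y | y. y \<in> Zmod q}"

definition L_block :: "nat \<Rightarrow> nat \<Rightarrow> vertex set" where
  "L_block q m = {Ln m b | b. b \<in> Zmod q}"

definition B_graph :: "nat \<Rightarrow> vertex graph" where
  "B_graph q = Graph ((\<Union>x\<in>Zmod q. P_block q x) \<union> (\<Union>m\<in>Zmod q. L_block q m))
     {{Pt x y, Ln m b} | x y m b.
        x \<in> Zmod q \<and> y \<in> Zmod q \<and> m \<in> Zmod q \<and> b \<in> Zmod q \<and> y = (m * x + b) mod q}"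

definition delete_verts :: "'a graph \<Rightarrow> 'a set \<Rightarrow> 'a graph" where
  "delete_verts G D = Graph (verts G - D) {e \<in> edges G. e \<inter> D = {}}"

definition U_set :: "nat \<Rightarrow> nat \<Rightarrow> nat \<Rightarrow> nat set" where
  "U_set q \<alpha> u = {\<alpha> ^ (q - j) mod q | j. j \<in> {2..u + 1}}"

definition B_deleted ::
    "nat \<Rightarrow> nat \<Rightarrow> nat set \<Rightarrow> nat set \<Rightarrow> nat \<Rightarrow> nat \<Rightarrow> vertex graph" where
  "B_deleted q \<alpha> S T u0 u1 = delete_verts (B_graph q)
     ({Pt 0 y | y. y \<in> S} \<union> {Ln 0 b | b. b \<in> T} \<union>
      (\<Union>x\<in>U_set q \<alpha> u0. P_block q x) \<union> (\<Union>m\<in>U_set q \<alpha> u1. L_block q m))"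

text \<open>Intended for \<open>T \<subseteq> S \<subseteq> \<int>\<^sub>q\<close>, \<open>u0 \<le> u1 < q - 1\<close>, and graphs \<open>H1\<close>, \<open>H2\<close>, \<open>G1\<close>, \<open>G2\<close> on
  \<open>\<int>\<^sub>q - S\<close>, \<open>\<int>\<^sub>q - T\<close>, \<open>\<int>\<^sub>q\<close>, \<open>\<int>\<^sub>q\<close>.\<close>

definition amalgam ::
    "nat \<Rightarrow> nat \<Rightarrow> nat set \<Rightarrow> nat set \<Rightarrow> nat \<Rightarrow> nat \<Rightarrow>
     nat graph \<Rightarrow> nat graph \<Rightarrow> nat graph \<Rightarrow> nat graph \<Rightarrow> vertex graph" where
  "amalgam q \<alpha> S T u0 u1 H1 H2 G1 G2 = Graph (verts (B_deleted q \<alpha> S T u0 u1))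
     (edges (B_deleted q \<alpha> S T u0 u1) \<union>
      {{Pt 0 u, Pt 0 v} | u v. {u, v} \<in> edges H1} \<union>
      {{Ln 0 u, Ln 0 v} | u v. {u, v} \<in> edges H2} \<union>
      {{Pt x u, Pt x v} | x u v. x \<in> Zmod q - {0} - U_set q \<alpha> u0 \<and> {u, v} \<in> edges G1} \<union>
      {{Ln m u, Ln m v} | m u v. m \<in> Zmod q - {0} - U_set q \<alpha> u1 \<and> {u, v} \<in> edges G2})"

text \<open>For such \<open>q\<close> every quotient below is an exact integer quotient lying in \<open>{0..<q}\<close>.\<close>

definition S_par :: "nat \<Rightarrow> nat set" where
  "S_par q = {(q - 1) div 4, (3 * q + 1) div 4}"

definition H1_par :: "nat \<Rightarrow> nat graph" where
  "H1_par q = Graph (Zmod q - {(q - 1) div 4, (3 * q + 1) div 4})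
     ({{j, (j + (q - 1) div 2) mod q} | j.
         j \<in> Zmod q - {(q - 1) div 4, (3 * q + 1) div 4, (q + 3) div 4}} \<union>
      {{(3 * q - 3) div 4, (q + 3) div 4}})"

definition G1_par :: "nat \<Rightarrow> nat graph" where
  "G1_par q = Graph (Zmod q) {{j, (j + (q - 1) div 2) mod q} | j. j \<in> Zmod q}"

definition H2_par :: "nat \<Rightarrow> nat graph" where
  "H2_par q = Graph (Zmod q)
     ({{0, j} | j. j \<in> Zmod q - {0} - {(q - 1) div 2, (q + 1) div 2}} \<union>
      {{(q - 1) div 4, (q - 1) div 2}, {(3 * q + 1) div 4, (q + 1) div 2}})"

definition G2_par :: "nat \<Rightarrow> nat graph" where
  "G2_par q = H2_par q"

end

theory Submission
  imports Defs
begin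

text \<open>A vertex of degree \<open>m\<close> in a graph of girth 5 and minimum degree \<open>r\<close> has \<open>m\<close> neighbours and
  at least \<open>m (r - 1)\<close> further vertices at distance two, so the order is at least \<open>1 + m r\<close>, which the
  amalgam attains. In \<open>B\<^sub>q\<close> there are no 4-cycles because \<open>\<int>\<^sub>q\<close> is a field. A new short cycle
  must either lie in a single block or consist of an edge in a point block, an edge in a line block and
  two edges of \<open>B\<^sub>q\<close>; then the two block edges have the same difference modulo \<open>q\<close> (they are even the
  same edge for the block \<open>P\<^sub>0\<close>). But \<open>G\<^sub>1\<close> has only the differences \<open>\<plusminus>(q - 1)/2\<close>, which
  are avoided by \<open>H\<^sub>2\<close>, and \<open>H\<^sub>1\<close>, \<open>H\<^sub>2\<close> are edge-disjoint.\<close>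

section \<open>Graphs of girth five\<close>

lemma degree_eq_card_neighbours:
  assumes "simple_graph G"
  shows "graph_degree G v = card {u. {v, u} \<in> edges G}"
proof -
  have "{e \<in> edges G. v \<in> e} = (\<lambda>u. {v, u}) ` {u. {v, u} \<in> edges G}"
  proof (intro equalityI subsetI)
    fix e assume e: "e \<in> {e \<in> edges G. v \<in> e}"
    hence "card e = 2" using assms by (auto simp: simple_graph_def)
    then obtain u where "e = {v, u}" using e by (auto simp: card_2_iff)
    thus "e \<in> (\<lambda>u. {v, u}) ` {u. {v, u} \<in> edges G}" using e by auto
  qed auto
  moreover have "inj_on (\<lambda>u. {v, u}) A" for A by (auto simp: inj_on_def doubleton_eq_iff)
  ultimately show ?thesis by (simp add: graph_degree_def card_image)
qed

lemma edge_in_verts: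
  assumes "simple_graph G" "{u, v} \<in> edges G"
  shows "u \<in> verts G" "v \<in> verts G" "u \<noteq> v"
  using assms by (auto simp: simple_graph_def card_2_iff doubleton_eq_iff)

lemma finite_neighbours:
  assumes "simple_graph G"
  shows "finite {u. {v, u} \<in> edges G}"
  by (rule finite_subset[of _ "verts G"])
    (use assms edge_in_verts in \<open>auto simp: simple_graph_def\<close>)

lemma is_cycle_3_iff:
  "is_cycle G [a, b, c] \<longleftrightarrow> distinct [a, b, c] \<and> {a, b, c} \<subseteq> verts G \<and>
    {a, b} \<in> edges G \<and> {b, c} \<in> edges G \<and> {c, a} \<in> edges G"
  unfolding is_cycle_def by (simp add: All_less_Suc) blast

lemma is_cycle_4_iff:
  "is_cycle G [a, b, c, d] \<longleftrightarrow> distinct [a, b, c, d] \<and> {a, b, c, d} \<subseteq> verts G \<and>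
    {a, b} \<in> edges G \<and> {b, c} \<in> edges G \<and> {c, d} \<in> edges G \<and> {d, a} \<in> edges G"
  unfolding is_cycle_def by (simp add: All_less_Suc) blast

text \<open>Replaces cycles as lists by conditions on edges alone, suited to case analysis on
  vertices. Consecutive vertices are distinct because every edge has two elements, so only
  coinciding opposite vertices have to be allowed in the second condition.\<close>

lemma girth_ge_5_iff:
  assumes "simple_graph G"
  shows "enat 5 \<le> girth G \<longleftrightarrow>
    (\<forall>a b c. {a, b} \<in> edges G \<longrightarrow> {b, c} \<in> edges G \<longrightarrow> {c, a} \<notin> edges G) \<and>
    (\<forall>a b c d. {a, b} \<in> edges G \<longrightarrow> {b, c} \<in> edges G \<longrightarrow> {c, d} \<in> edges G \<longrightarrow>
       {d, a} \<in> edges G \<longrightarrow> a = c \<or> b = d)" (is "_ \<longleftrightarrow> ?T \<and> ?Q")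
proof
  assume g: "enat 5 \<le> girth G"
  have long: "5 \<le> length c" if "is_cycle G c" for c
  proof -
    have "girth G \<le> enat (length c)"
      unfolding girth_def by (rule Inf_lower) (use that in blast)
    thus ?thesis using g by (meson enat_ord_simps(1) order_trans)
  qed
  have ?T
  proof (intro allI impI notI)
    fix a b c assume e: "{a, b} \<in> edges G" "{b, c} \<in> edges G" "{c, a} \<in> edges G"
    have "is_cycle G [a, b, c]"
      using e edge_in_verts[OF assms e(1)] edge_in_verts[OF assms e(2)] edge_in_verts[OF assms e(3)]
      by (simp add: is_cycle_3_iff)
    from long[OF this] show False by simp
  qed
  moreover have ?Q
  proof (intro allI impI, rule ccontr)
    fix a b c d assume e: "{a, b} \<in> edges G" "{b, c} \<in> edges G" "{c, d} \<in> edges G"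
      "{d, a} \<in> edges G" and ne: "\<not> (a = c \<or> b = d)"
    have "is_cycle G [a, b, c, d]"
      using e ne edge_in_verts[OF assms e(1)] edge_in_verts[OF assms e(2)]
        edge_in_verts[OF assms e(3)] edge_in_verts[OF assms e(4)]
      by (simp add: is_cycle_4_iff)
    from long[OF this] show False by simp
  qed
  ultimately show "?T \<and> ?Q" by blast
next
  assume TQ: "?T \<and> ?Q"
  show "enat 5 \<le> girth G"
    unfolding girth_def
  proof (rule Inf_greatest, clarsimp, rule ccontr)
    fix c assume c: "is_cycle G c" and "\<not> 5 \<le> length c"
    hence "length c = 3 \<or> length c = 4" by (auto simp: is_cycle_def)
    thus False
    proof
      assume l: "length c = 3"
      then obtain x y z where "c = [x, y, z]"
        by (simp add: numeral_eq_Suc length_Suc_conv) blast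
      hence "is_cycle G [x, y, z]" using c by simp
      thus False using TQ unfolding is_cycle_3_iff by blast
    next
      assume l: "length c = 4"
      then obtain x y z w where "c = [x, y, z, w]"
        by (simp add: numeral_eq_Suc length_Suc_conv) blast
      hence "is_cycle G [x, y, z, w]" using c by simp
      thus False using TQ unfolding is_cycle_4_iff by (metis distinct_length_2_or_more)
    qed
  qed
qed

section \<open>The order bound for girth five\<close>

lemma biregular_order_lower_bound:
  assumes G: "biregular_graph r m 5 G"
  shows "r * m + 1 \<le> graph_order G"
proof -
  have simple: "simple_graph G" and fin: "finite (verts G)" and r: "2 \<le> r"
    using G by (auto simp: biregular_graph_def simple_graph_def)
  have "enat 5 \<le> girth G" using G by (simp add: biregular_graph_def)
  note girth = this[unfolded girth_ge_5_iff[OF simple]]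
  define N where "N = (\<lambda>v. {u. {v, u} \<in> edges G})"
  have finN: "finite (N v)" and degN: "graph_degree G v = card (N v)" for v
    using finite_neighbours[OF simple] degree_eq_card_neighbours[OF simple] by (auto simp: N_def)
  have NV: "N v \<subseteq> verts G" and irr: "v \<notin> N v" for v
    using edge_in_verts[OF simple] edge_in_verts(3)[OF simple, of v v] by (auto simp: N_def)
  have sym: "u \<in> N v \<longleftrightarrow> v \<in> N u" for u v by (simp add: N_def insert_commute)
  have tri: "a \<notin> N c" if "b \<in> N a" "c \<in> N b" for a b c
    using girth[THEN conjunct1, rule_format, of a b c] that by (auto simp: N_def)
  have quad: "a = c \<or> b = d" if "b \<in> N a" "c \<in> N b" "d \<in> N c" "a \<in> N d" for a b c d
    using girth[THEN conjunct2, rule_format, of a b c d] that by (simp add: N_def)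
  have "m \<in> graph_degree G ` verts G" using G by (simp add: biregular_graph_def)
  then obtain v where v: "v \<in> verts G" "card (N v) = m" using degN by auto
  have big: "r \<le> card (N u)" if "u \<in> verts G" for u
  proof -
    have "graph_degree G u \<in> {r, m}" using G that by (auto simp: biregular_graph_def)
    thus ?thesis using G degN by (auto simp: biregular_graph_def)
  qed
  \<comment> \<open>\<open>D\<close> is the set of vertices at distance two from \<open>v\<close>.
    Each \<open>N u\<close> contains \<open>v\<close>, so removing it leaves at least
    \<open>r - 1\<close> vertices per neighbour \<open>u\<close>.\<close>
  define D where "D = (\<Union>u\<in>N v. N u - {v})"
  have "m * (r - 1) = (\<Sum>u\<in>N v. r - 1)" using v by simp
  also have "\<dots> \<le> (\<Sum>u\<in>N v. card (N u - {v}))"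
  proof (rule sum_mono)
    fix u assume u: "u \<in> N v"
    hence "card (N u - {v}) = card (N u) - 1" using sym by simp
    moreover have "r \<le> card (N u)" using big NV u by blast
    ultimately show "r - 1 \<le> card (N u - {v})" by simp
  qed
  also have "\<dots> = card D"
    unfolding D_def
  proof (rule card_UN_disjoint[symmetric])
    \<comment> \<open>A common element \<open>x\<close> of the sets for \<open>u\<close> and
      \<open>w\<close> would give the 4-cycle \<open>v\<close>, \<open>u\<close>, \<open>x\<close>,
      \<open>w\<close>.\<close>
    show "\<forall>u\<in>N v. \<forall>w\<in>N v. u \<noteq> w \<longrightarrow> (N u - {v}) \<inter> (N w - {v}) = {}"
    proof (intro ballI impI equals0I)
      fix u w x assume "u \<in> N v" "w \<in> N v" "u \<noteq> w" "x \<in> (N u - {v}) \<inter> (N w - {v})"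
      thus False using quad[of u v x w] sym[of x w] sym[of v w] by auto
    qed
  qed (use finN in auto)
  finally have D: "m * (r - 1) \<le> card D" .
  have "card (insert v (N v \<union> D)) = 1 + (card (N v) + card D)"
  proof -
    have "finite D" using finN by (auto simp: D_def)
    \<comment> \<open>A vertex in both sets would close a triangle through \<open>v\<close>.\<close>
    moreover have "N v \<inter> D = {}"
    proof (rule equals0I)
      fix x assume "x \<in> N v \<inter> D"
      then obtain u where "x \<in> N v" "u \<in> N v" "x \<in> N u" by (auto simp: D_def)
      thus False using tri[of u v x] sym[of v x] by simp
    qed
    moreover have "v \<notin> N v \<union> D" using irr by (auto simp: D_def)
    ultimately show ?thesis using finN by (simp add: card_Un_disjoint)
  qed
  moreover have "card (insert v (N v \<union> D)) \<le> card (verts G)"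
    by (rule card_mono[OF fin]) (use v NV in \<open>auto simp: D_def\<close>)
  ultimately have "1 + (m + m * (r - 1)) \<le> card (verts G)" using D v(2) by linarith
  moreover have "m + m * (r - 1) = r * m" using r by (cases r) (auto simp: algebra_simps)
  ultimately show ?thesis by (simp add: graph_order_def)
qed

section \<open>The graphs added to the blocks\<close>

text \<open>For \<open>u, v < q = 4 n + 1\<close> this says that \<open>u - v\<close> is \<open>\<plusminus>(q - 1)/2\<close> modulo \<open>q\<close>.\<close>

definition half_step :: "nat \<Rightarrow> nat \<Rightarrow> nat \<Rightarrow> bool" where
  "half_step n u v \<longleftrightarrow> u = v + 2 * n \<or> u = v + 2 * n + 1 \<or> v = u + 2 * n \<or> v = u + 2 * n + 1"

text \<open>Adding \<open>2 * n\<close> modulo \<open>4 * n + 1\<close> adds \<open>2 * n\<close> to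
  a representative up to \<open>2 * n\<close> and subtracts \<open>2 * n + 1\<close> from a larger
  one. The four cases of \<open>half_step\<close> are these two shifts in both directions; they are
  linear and free of \<open>mod\<close>.\<close>

lemma half_step_iff:
  assumes "q = 4 * n + 1" "u < q" "v < q"
  shows "half_step n u v \<longleftrightarrow> v = (u + 2 * n) mod q \<or> u = (v + 2 * n) mod q"
proof -
  have s: "(w + 2 * n) mod q = (if w \<le> 2 * n then w + 2 * n else w - (2 * n + 1))"
    if "w < q" for w
    using that assms(1) by (auto simp: mod_if)
  show ?thesis
    unfolding s[OF assms(2)] s[OF assms(3)] half_step_def using assms by auto
qed

lemma G1_par_edge:
  assumes "q = 4 * n + 1"
  shows "{u, v} \<in> edges (G1_par q) \<longleftrightarrow> u < q \<and> v < q \<and> half_step n u v"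
proof -
  have q: "(q - 1) div 2 = 2 * n" "0 < q" using assms by auto
  have "{u, v} \<in> edges (G1_par q) \<longleftrightarrow>
    u < q \<and> v = (u + 2 * n) mod q \<or> v < q \<and> u = (v + 2 * n) mod q"
    unfolding G1_par_def Zmod_def q by (auto simp: doubleton_eq_iff)
  thus ?thesis
    using half_step_iff[OF assms, of u v] mod_less_divisor[OF q(2)] by blast
qed

text \<open>The cycle of \<open>G1_par\<close> contains the path \<open>n + 1\<close>,
  \<open>3 * n + 1\<close>, \<open>n\<close>, \<open>3 * n\<close>. Leaving out the steps that start
  at its first three vertices removes exactly the edges at the two deleted vertices, and the extra
  edge between \<open>3 * n\<close> and \<open>n + 1\<close> closes the gap.\<close>

lemma H1_par_edge:
  assumes "q = 4 * n + 1" "n \<ge> 3"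
  shows "{u, v} \<in> edges (H1_par q) \<longleftrightarrow>
    u < q \<and> v < q \<and> u \<noteq> n \<and> v \<noteq> n \<and> u \<noteq> 3 * n + 1 \<and> v \<noteq> 3 * n + 1 \<and>
    (half_step n u v \<or> u = 3 * n \<and> v = n + 1 \<or> u = n + 1 \<and> v = 3 * n)"
proof -
  have d: "(q - 1) div 4 = n" "(3 * q + 1) div 4 = 3 * n + 1" "(q + 3) div 4 = n + 1"
    "(q - 1) div 2 = 2 * n" "(3 * q - 3) div 4 = 3 * n"
    using assms by auto
  have s: "(w + 2 * n) mod q = (if w \<le> 2 * n then w + 2 * n else w - (2 * n + 1))"
    if "w < q" for w
    using that assms(1) by (auto simp: mod_if)
  have f: "(w + 2 * n) mod q = n \<longleftrightarrow> w = 3 * n + 1"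
    "(w + 2 * n) mod q = 3 * n + 1 \<longleftrightarrow> w = n + 1" if "w < q" for w
    unfolding s[OF that] using that assms by auto
  have e: "{u, v} \<in> edges (H1_par q) \<longleftrightarrow>
    u < q \<and> u \<noteq> n \<and> u \<noteq> 3 * n + 1 \<and> u \<noteq> n + 1 \<and> v = (u + 2 * n) mod q \<or>
    v < q \<and> v \<noteq> n \<and> v \<noteq> 3 * n + 1 \<and> v \<noteq> n + 1 \<and> u = (v + 2 * n) mod q \<or>
    u = 3 * n \<and> v = n + 1 \<or> u = n + 1 \<and> v = 3 * n"
    unfolding H1_par_def d Zmod_def by (auto simp: doubleton_eq_iff)
  have lt: "(w + 2 * n) mod q < q" "3 * n < q" "n + 1 < q" for w using assms by auto
  have ne: "n + 1 \<noteq> n" "n + 1 \<noteq> 3 * n + 1" "3 * n \<noteq> n" "3 * n \<noteq> 3 * n + 1" using assms(2) by auto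
  show ?thesis
  proof (cases "u < q \<and> v < q")
    case True
    show ?thesis unfolding e half_step_iff[OF assms(1) True[THEN conjunct1] True[THEN conjunct2]]
      using f[of u] f[of v] True ne by metis
  next
    case False
    thus ?thesis unfolding e using lt by metis
  qed
qed

text \<open>Since \<open>2 (q - 1)/2 = -1\<close> modulo \<open>q\<close>, two steps to a different vertex amount to adding \<open>\<plusminus>1\<close>,
  and the end points determine the midpoint.\<close>

definition two_half_steps :: "nat \<Rightarrow> nat \<Rightarrow> nat \<Rightarrow> nat \<Rightarrow> bool" where
  "two_half_steps n u v w \<longleftrightarrow> u \<le> 4 * n \<and> v \<le> 4 * n \<and> w \<le> 4 * n \<and>
    (w = u + 1 \<and> (v = u + 2 * n + 1 \<or> u = v + 2 * n) \<or>
     u = w + 1 \<and> (v = w + 2 * n + 1 \<or> w = v + 2 * n) \<or>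
     u = 0 \<and> v = 2 * n \<and> w = 4 * n \<or> u = 4 * n \<and> v = 2 * n \<and> w = 0)"

lemma two_half_stepsI:
  assumes "u < 4 * n + 1" "v < 4 * n + 1" "w < 4 * n + 1" "u \<noteq> w"
    and "half_step n u v" "half_step n v w"
  shows "two_half_steps n u v w"
  using assms unfolding half_step_def two_half_steps_def
  by (elim disjE) simp_all

lemma two_half_steps_unique:
  assumes "two_half_steps n u v w" "two_half_steps n u v' w" "n \<ge> 3"
  shows "v = v'"
  using assms unfolding two_half_steps_def by auto

text \<open>The ends of two half steps differ by 1 or \<open>4 * n\<close>. Paths through the extra
  edge of \<open>H1_par\<close> have ends differing by 2, so the two kinds of path never share both
  ends.\<close>

lemma two_half_steps_diff:
  assumes "two_half_steps n u v w" "n \<ge> 3"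
  shows "w \<noteq> u + 2" "u \<noteq> w + 2"
  using assms unfolding two_half_steps_def by auto

lemma G1_par_two_steps:
  assumes "q = 4 * n + 1" "n \<ge> 3"
    and "{u, v} \<in> edges (G1_par q)" "{v, w} \<in> edges (G1_par q)" "u \<noteq> w"
  shows "two_half_steps n u v w"
  using assms(2-) two_half_stepsI unfolding G1_par_edge[OF assms(1)] unfolding assms(1) by blast

text \<open>The four exceptional paths use the extra edge. Its end \<open>n + 1\<close> keeps only
  the half step to \<open>3 * n + 2\<close>, since \<open>3 * n + 1\<close> is deleted; its end
  \<open>3 * n\<close> keeps only the one to \<open>n - 1\<close>, since \<open>n\<close> is
  deleted.\<close>

lemma H1_par_two_steps:
  assumes "q = 4 * n + 1" "n \<ge> 3"
    and "{u, v} \<in> edges (H1_par q)" "{v, w} \<in> edges (H1_par q)" "u \<noteq> w"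
  shows "two_half_steps n u v w \<or> u = 3 * n \<and> v = n + 1 \<and> w = 3 * n + 2 \<or>
    u = 3 * n + 2 \<and> v = n + 1 \<and> w = 3 * n \<or> u = n + 1 \<and> v = 3 * n \<and> w = n - 1 \<or>
    u = n - 1 \<and> v = 3 * n \<and> w = n + 1"
proof (cases "half_step n u v \<and> half_step n v w")
  case True
  thus ?thesis
    using assms(2-) two_half_stepsI unfolding H1_par_edge[OF assms(1,2)] unfolding assms(1) by blast
next
  case False
  have d: "n + 1 \<noteq> 3 * n" using assms(2) by simp
  consider "u = 3 * n" "v = n + 1" "half_step n v w" | "u = n + 1" "v = 3 * n" "half_step n v w"
    | "w = 3 * n" "v = n + 1" "half_step n u v" | "w = n + 1" "v = 3 * n" "half_step n u v"
    using False assms(3-) d unfolding H1_par_edge[OF assms(1,2)] by metis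
  moreover have "z = 3 * n + 2" if "half_step n (n + 1) z" "z \<noteq> 3 * n + 1" for z
    using that assms(2) unfolding half_step_def by (elim disjE) simp_all
  moreover have "z = n - 1" if "half_step n (3 * n) z" "z \<noteq> n" "z < 4 * n + 1" for z
    using that assms(2) unfolding half_step_def by (elim disjE) simp_all
  moreover have "half_step n v u \<longleftrightarrow> half_step n u v" unfolding half_step_def by blast
  moreover have "u < 4 * n + 1" "w < 4 * n + 1" "u \<noteq> n" "w \<noteq> n" "u \<noteq> 3 * n + 1" "w \<noteq> 3 * n + 1"
    using assms(3,4) unfolding H1_par_edge[OF assms(1,2)] unfolding assms(1) by blast+
  ultimately show ?thesis by cases metis+
qed

section \<open>Absence of triangles and quadrangles in the block graphs\<close>

lemma G1_par_triangle_free: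
  assumes "q = 4 * n + 1" "n \<ge> 3"
    and e: "{a, b} \<in> edges (G1_par q)" "{b, c} \<in> edges (G1_par q)"
  shows "{c, a} \<notin> edges (G1_par q)"
proof
  assume e': "{c, a} \<in> edges (G1_par q)"
  hence "a \<noteq> c" using assms(2) by (auto simp: G1_par_edge[OF assms(1)] half_step_def)
  from G1_par_two_steps[OF assms this] e' assms(2) show False
    unfolding two_half_steps_def G1_par_edge[OF assms(1)] half_step_def by auto
qed

text \<open>A quadrangle consists of two paths of length two with common ends, and the ends
  determine the midpoint. The quadrangle lemmas for \<open>H1_par\<close> and \<open>H2_par\<close>
  follow the same pattern.\<close>

lemma G1_par_quadrangle_free:
  assumes "q = 4 * n + 1" "n \<ge> 3"
    and e: "{a, b} \<in> edges (G1_par q)" "{b, c} \<in> edges (G1_par q)"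
      "{c, d} \<in> edges (G1_par q)" "{d, a} \<in> edges (G1_par q)"
  shows "a = c \<or> b = d"
proof (rule ccontr)
  assume "\<not> ?thesis"
  hence ne: "a \<noteq> c" "b \<noteq> d" by auto
  have e': "{a, d} \<in> edges (G1_par q)" "{d, c} \<in> edges (G1_par q)"
    using e by (auto simp: insert_commute)
  from two_half_steps_unique[OF G1_par_two_steps[OF assms(1,2) e(1,2) ne(1)]
      G1_par_two_steps[OF assms(1,2) e' ne(1)] assms(2)] ne(2)
  show False by simp
qed

lemma H1_par_triangle_free:
  assumes "q = 4 * n + 1" "n \<ge> 3"
    and e: "{a, b} \<in> edges (H1_par q)" "{b, c} \<in> edges (H1_par q)"
  shows "{c, a} \<notin> edges (H1_par q)"
proof
  assume e': "{c, a} \<in> edges (H1_par q)"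
  hence "a \<noteq> c" using assms(2) by (auto simp: H1_par_edge[OF assms(1,2)] half_step_def)
  have "half_step n c a \<or> c = 3 * n \<and> a = n + 1 \<or> c = n + 1 \<and> a = 3 * n"
    using e' unfolding H1_par_edge[OF assms(1,2)] by blast
  with H1_par_two_steps[OF assms \<open>a \<noteq> c\<close>] assms(2) show False
    unfolding two_half_steps_def half_step_def by (elim disjE conjE) simp_all
qed

lemma H1_par_quadrangle_free:
  assumes "q = 4 * n + 1" "n \<ge> 3"
    and e: "{a, b} \<in> edges (H1_par q)" "{b, c} \<in> edges (H1_par q)"
      "{c, d} \<in> edges (H1_par q)" "{d, a} \<in> edges (H1_par q)"
  shows "a = c \<or> b = d"
proof (rule ccontr)
  assume "\<not> ?thesis"
  hence ne: "a \<noteq> c" "b \<noteq> d" by auto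
  have e': "{a, d} \<in> edges (H1_par q)" "{d, c} \<in> edges (H1_par q)"
    using e by (auto simp: insert_commute)
  \<comment> \<open>The equation shows that \<open>n - 1\<close> and \<open>n + 1\<close> differ by
    2, as needed for \<open>two_half_steps_diff\<close>; the inequalities tell the exceptional paths
    apart.\<close>
  have n: "n + 1 = n - 1 + 2" "3 * n \<noteq> n + 1" "3 * n \<noteq> n - 1" "3 * n + 2 \<noteq> n + 1"
    "3 * n + 2 \<noteq> n - 1" "n + 1 \<noteq> n - 1" "3 * n + 2 \<noteq> 3 * n"
    using assms(2) by auto
  show False
    using H1_par_two_steps[OF assms(1,2) e(1,2) ne(1)] H1_par_two_steps[OF assms(1,2) e' ne(1)]
      ne(2) two_half_steps_unique[OF _ _ assms(2), of a b c d]
      two_half_steps_diff[OF _ assms(2), of a b c] two_half_steps_diff[OF _ assms(2), of a d c] n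
    by metis
qed

text \<open>The graph is a tree: a star centred at 0, except that \<open>2 * n\<close> and
  \<open>2 * n + 1\<close> hang as leaves from \<open>n\<close> and \<open>3 * n + 1\<close>.
  Joining these two to 0 would create half steps.\<close>

lemma H2_par_edge:
  assumes "q = 4 * n + 1" "n \<ge> 3"
  shows "{u, v} \<in> edges (H2_par q) \<longleftrightarrow>
    u = 0 \<and> v < q \<and> v \<noteq> 0 \<and> v \<noteq> 2 * n \<and> v \<noteq> 2 * n + 1 \<or>
    v = 0 \<and> u < q \<and> u \<noteq> 0 \<and> u \<noteq> 2 * n \<and> u \<noteq> 2 * n + 1 \<or>
    u = n \<and> v = 2 * n \<or> u = 2 * n \<and> v = n \<or>
    u = 3 * n + 1 \<and> v = 2 * n + 1 \<or> u = 2 * n + 1 \<and> v = 3 * n + 1"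
proof -
  have d: "(q - 1) div 4 = n" "(3 * q + 1) div 4 = 3 * n + 1" "(q + 1) div 2 = 2 * n + 1"
    "(q - 1) div 2 = 2 * n" 
    using assms by auto
  show ?thesis
    unfolding H2_par_def d Zmod_def using assms by (auto simp: doubleton_eq_iff)
qed

text \<open>The middle vertex has degree at least two, hence is 0, \<open>n\<close> or
  \<open>3 * n + 1\<close>. In each case the ends determine it.\<close>

lemma H2_par_two_steps:
  assumes "q = 4 * n + 1" "n \<ge> 3"
    and e: "{u, v} \<in> edges (H2_par q)" "{v, w} \<in> edges (H2_par q)" and ne: "u \<noteq> w"
  shows "v = 0 \<and> u \<notin> {0, 2 * n, 2 * n + 1} \<and> w \<notin> {0, 2 * n, 2 * n + 1} \<or>
    u = 0 \<and> (v = n \<and> w = 2 * n \<or> v = 3 * n + 1 \<and> w = 2 * n + 1) \<or>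
    w = 0 \<and> (v = n \<and> u = 2 * n \<or> v = 3 * n + 1 \<and> u = 2 * n + 1)"
proof -
  have n: "n \<noteq> 0" "3 * n + 1 \<noteq> 0" "2 * n \<noteq> 0" "2 * n + 1 \<noteq> 0" "n \<noteq> 2 * n" "n \<noteq> 2 * n + 1"
    "n \<noteq> 3 * n + 1" "3 * n + 1 \<noteq> 2 * n" "3 * n + 1 \<noteq> 2 * n + 1" "2 * n + 1 \<noteq> 2 * n"
    using assms(2) by auto
  show ?thesis
    using e ne n unfolding H2_par_edge[OF assms(1,2)] insert_iff empty_iff by metis
qed

lemma H2_par_triangle_free:
  assumes "q = 4 * n + 1" "n \<ge> 3"
    and e: "{a, b} \<in> edges (H2_par q)" "{b, c} \<in> edges (H2_par q)"
  shows "{c, a} \<notin> edges (H2_par q)"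
proof
  assume e': "{c, a} \<in> edges (H2_par q)"
  hence "a \<noteq> c" using assms(2) unfolding H2_par_edge[OF assms(1,2)] by auto
  from H2_par_two_steps[OF assms this] e' assms(2) show False
    unfolding H2_par_edge[OF assms(1,2)] by auto
qed

lemma H2_par_quadrangle_free:
  assumes "q = 4 * n + 1" "n \<ge> 3"
    and e: "{a, b} \<in> edges (H2_par q)" "{b, c} \<in> edges (H2_par q)"
      "{c, d} \<in> edges (H2_par q)" "{d, a} \<in> edges (H2_par q)"
  shows "a = c \<or> b = d"
proof (rule ccontr)
  assume "\<not> ?thesis"
  hence ne: "a \<noteq> c" "b \<noteq> d" by auto
  have e': "{a, d} \<in> edges (H2_par q)" "{d, c} \<in> edges (H2_par q)"
    using e by (auto simp: insert_commute)
  show False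
    using H2_par_two_steps[OF assms(1,2) e(1,2) ne(1)] H2_par_two_steps[OF assms(1,2) e' ne(1)]
      ne(2) assms(2) by auto
qed

section \<open>Degrees inside the blocks\<close>

lemma card_G1_par_neighbours:
  assumes "q = 4 * n + 1" "n \<ge> 3" "y < q"
  shows "card {v. {y, v} \<in> edges (G1_par q)} = 2"
proof -
  \<comment> \<open>Both half steps go up from a vertex below \<open>2 * n\<close> and down from one
    above it; from \<open>2 * n\<close> itself one goes up to \<open>4 * n\<close> and the other
    down to 0.\<close>
  have "{v. {y, v} \<in> edges (G1_par q)} =
    (if y < 2 * n then {y + 2 * n, y + 2 * n + 1} else if y = 2 * n then {4 * n, 0}
     else {y - 2 * n, y - (2 * n + 1)})"
    using assms(3) unfolding G1_par_edge[OF assms(1)] half_step_def unfolding assms(1)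
    by (auto split: if_splits)
  thus ?thesis using assms by simp
qed

lemma card_H1_par_neighbours:
  assumes "q = 4 * n + 1" "n \<ge> 3" "y < q" "y \<noteq> n" "y \<noteq> 3 * n + 1"
  shows "card {v. {y, v} \<in> edges (H1_par q)} = 2"
proof -
  \<comment> \<open>Only \<open>n + 1\<close> and \<open>3 * n\<close> lose a neighbour to the
    deletion, and each gains the other through the extra edge.\<close>
  have "{v. {y, v} \<in> edges (H1_par q)} =
    (if y = n + 1 then {3 * n, 3 * n + 2} else if y = 3 * n then {n - 1, n + 1}
     else {v. {y, v} \<in> edges (G1_par q)})"
    using assms(2-) unfolding G1_par_edge[OF assms(1)] H1_par_edge[OF assms(1,2)] half_step_def
    unfolding assms(1) by (auto split: if_splits)
  thus ?thesis using assms card_G1_par_neighbours by auto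
qed

lemma card_H2_par_neighbours:
  assumes "q = 4 * n + 1" "n \<ge> 3" "b < q"
  shows "card {v. {b, v} \<in> edges (H2_par q)} =
    (if b = 0 then q - 3 else if b = n \<or> b = 3 * n + 1 then 2 else 1)"
proof -
  have "{v. {b, v} \<in> edges (H2_par q)} =
    (if b = 0 then {0..<q} - {0, 2 * n, 2 * n + 1} else if b = n then {0, 2 * n} else
     if b = 3 * n + 1 then {0, 2 * n + 1} else if b = 2 * n then {n} else
     if b = 2 * n + 1 then {3 * n + 1} else {0})"
    using assms(2-) unfolding H2_par_edge[OF assms(1,2)]
    unfolding assms(1) by (auto split: if_splits)
  thus ?thesis using assms by (auto simp: card_Diff_subset)
qed

lemma int_dvd_diff_less_imp_eq:
  fixes a b q :: nat
  assumes "int q dvd int a - int b" "a < q" "b < q"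
  shows "a = b"
proof -
  have "[int a = int b] (mod int q)" using assms(1) by (simp add: cong_iff_dvd_diff)
  thus ?thesis using assms(2,3) cong_int_iff cong_less_modulus_unique_nat by blast
qed

section \<open>The amalgam\<close>

locale amalgam_parameters =
  fixes n q \<alpha> :: nat
  assumes q_eq: "q = 4 * n + 1" and prime_q: "prime q" and n_ge: "n \<ge> 3"
    and coprime_\<alpha>: "coprime q \<alpha>"
begin

text \<open>The slope of the only deleted line block: for \<open>u1 = 1\<close> the index in
  \<open>U_set\<close> takes just the value 2.\<close>

definition \<mu> :: nat where "\<mu> = \<alpha> ^ (q - 2) mod q"

definition B :: "vertex graph" where
  "B = amalgam q \<alpha> (S_par q) {} 0 1 (H1_par q) (H2_par q) (G1_par q) (G2_par q)"

text \<open>One family for all point blocks, none of which is deleted entirely. On the line side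
  \<open>H2_par\<close> already serves every block.\<close>

definition E :: "nat \<Rightarrow> nat graph" where "E x = (if x = 0 then H1_par q else G1_par q)"

section \<open>Vertices and edges of the amalgam\<close>

lemma S_par_eq: "S_par q = {n, 3 * n + 1}"
  using n_ge by (auto simp: S_par_def q_eq)

lemma U_set_0: "U_set q \<alpha> 0 = {}"
  by (simp add: U_set_def)

lemma U_set_1: "U_set q \<alpha> 1 = {\<mu>}"
proof -
  have *: "{2..1 + 1} = {2::nat}" by simp
  show ?thesis unfolding U_set_def * \<mu>_def by simp
qed

lemma q_gt: "q > 12" using n_ge q_eq by simp

lemma \<mu>_less: "\<mu> < q" using q_gt by (simp add: \<mu>_def)

text \<open>Ensures that the block of lines of slope 0 survives, so that its edges can be merged
  with those of the other line blocks. The prime \<open>q\<close> divides no power of a number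
  coprime to it.\<close>

lemma \<mu>_pos: "\<mu> \<noteq> 0"
proof
  assume "\<mu> = 0"
  hence "q dvd \<alpha> ^ (q - 2)" by (auto simp: \<mu>_def)
  hence "q dvd \<alpha>" using prime_q prime_dvd_power by blast
  thus False using coprime_\<alpha> q_gt by (simp add: coprime_absorb_left)
qed

lemma B_verts:
  "verts B = (\<Union>x\<in>{..<q}. Pt x ` {..<q}) - Pt 0 ` {n, 3 * n + 1} \<union> (\<Union>m\<in>{..<q} - {\<mu>}. Ln m ` {..<q})"
  unfolding B_def amalgam_def B_deleted_def delete_verts_def B_graph_def S_par_eq U_set_0 U_set_1
    P_block_def L_block_def Zmod_def
  using \<mu>_less by auto

lemma verts_iff:
  "Pt x y \<in> verts B \<longleftrightarrow> x < q \<and> y < q \<and> \<not> (x = 0 \<and> y \<in> {n, 3 * n + 1})"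
  "Ln m b \<in> verts B \<longleftrightarrow> m < q \<and> b < q \<and> m \<noteq> \<mu>"
  unfolding B_verts by auto

lemma B_deleted_edges:
  "edges (B_deleted q \<alpha> (S_par q) {} 0 1) = {{Pt x y, Ln m b} | x y m b.
     x < q \<and> m < q \<and> b < q \<and> m \<noteq> \<mu> \<and> y = (m * x + b) mod q \<and> \<not> (x = 0 \<and> y \<in> {n, 3 * n + 1})}"
    (is "_ = ?R")
proof -
  define D where "D = {Pt 0 y | y. y \<in> S_par q} \<union> {Ln 0 b | b. b \<in> {}} \<union>
    (\<Union>x\<in>U_set q \<alpha> 0. P_block q x) \<union> (\<Union>m\<in>U_set q \<alpha> 1. L_block q m)"
  have D: "Pt x y \<in> D \<longleftrightarrow> x = 0 \<and> y \<in> {n, 3 * n + 1}" "Ln m b \<in> D \<longleftrightarrow> m = \<mu> \<and> b < q" for x y m b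
    unfolding D_def S_par_eq U_set_0 U_set_1 L_block_def Zmod_def by auto
  have e: "edges (B_deleted q \<alpha> (S_par q) {} 0 1) = {{Pt x y, Ln m b} | x y m b.
      x \<in> Zmod q \<and> y \<in> Zmod q \<and> m \<in> Zmod q \<and> b \<in> Zmod q \<and> y = (m * x + b) mod q \<and>
      Pt x y \<notin> D \<and> Ln m b \<notin> D}"
    unfolding B_deleted_def delete_verts_def B_graph_def graph.sel D_def[symmetric]
    by (intro equalityI subsetI; clarsimp; blast)
  have Z: "w \<in> Zmod q \<longleftrightarrow> w < q" for w by (simp add: Zmod_def)
  have c: "(x < q \<and> y < q \<and> m < q \<and> b < q \<and> y = (m * x + b) mod q \<and>
      \<not> (x = 0 \<and> y \<in> {n, 3 * n + 1}) \<and> \<not> (m = \<mu> \<and> b < q)) \<longleftrightarrow>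
    (x < q \<and> m < q \<and> b < q \<and> m \<noteq> \<mu> \<and> y = (m * x + b) mod q \<and> \<not> (x = 0 \<and> y \<in> {n, 3 * n + 1}))"
    for x y m b
    using mod_less_divisor[of q "m * x + b"] q_gt by auto
  show ?thesis unfolding e D Z c ..
qed

text \<open>Merging block 0 with the other blocks leaves three kinds of edges, told apart by the
  constructors of their ends. This yields one rewrite rule per pair of constructors.\<close>

lemma B_edges:
  "edges B = {{Pt x y, Ln m b} | x y m b.
     x < q \<and> m < q \<and> b < q \<and> m \<noteq> \<mu> \<and> y = (m * x + b) mod q \<and> \<not> (x = 0 \<and> y \<in> {n, 3 * n + 1})}
    \<union> {{Pt x y, Pt x y'} | x y y'. x < q \<and> {y, y'} \<in> edges (E x)}
    \<union> {{Ln m b, Ln m b'} | m b b'. m < q \<and> m \<noteq> \<mu> \<and> {b, b'} \<in> edges (H2_par q)}" (is "_ = ?R \<union> ?P \<union> ?L")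
proof -
  have P: "?P = {{Pt 0 u, Pt 0 v} | u v. {u, v} \<in> edges (H1_par q)} \<union>
      {{Pt x u, Pt x v} | x u v. x \<in> Zmod q - {0} - U_set q \<alpha> 0 \<and> {u, v} \<in> edges (G1_par q)}"
    (is "_ = ?PA \<union> ?PB")
  proof (intro equalityI subsetI)
    fix e assume "e \<in> ?P"
    then obtain x y y' where e: "e = {Pt x y, Pt x y'}" "x < q" "{y, y'} \<in> edges (E x)"
      by (elim CollectE exE conjE) (rule that)
    show "e \<in> ?PA \<union> ?PB"
    proof (cases "x = 0")
      case True
      hence "{y, y'} \<in> edges (H1_par q)" using e(3) by (simp add: E_def)
      thus ?thesis using e(1) True by blast
    next
      case False
      hence "{y, y'} \<in> edges (G1_par q)" "x \<in> Zmod q - {0} - U_set q \<alpha> 0"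
        using e(2,3) by (simp_all add: E_def Zmod_def U_set_0)
      thus ?thesis using e(1) by blast
    qed
  next
    fix e assume "e \<in> ?PA \<union> ?PB"
    then consider u v where "e = {Pt 0 u, Pt 0 v}" "{u, v} \<in> edges (H1_par q)"
      | x u v where "e = {Pt x u, Pt x v}" "x \<in> Zmod q - {0}" "{u, v} \<in> edges (G1_par q)"
      by (elim UnE CollectE exE conjE) auto
    thus "e \<in> ?P"
    proof cases
      case 1
      hence "0 < q" "{u, v} \<in> edges (E 0)" using q_gt by (simp_all add: E_def)
      thus ?thesis using 1(1) by blast
    next
      case 2
      hence "x < q" "{u, v} \<in> edges (E x)" by (simp_all add: E_def Zmod_def)
      thus ?thesis using 2(1) by blast
    qed
  qed
  have L: "?L = {{Ln 0 u, Ln 0 v} | u v. {u, v} \<in> edges (H2_par q)} \<union>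
      {{Ln m u, Ln m v} | m u v. m \<in> Zmod q - {0} - U_set q \<alpha> 1 \<and> {u, v} \<in> edges (G2_par q)}"
    (is "_ = ?LA \<union> ?LB")
  proof (intro equalityI subsetI)
    fix e assume "e \<in> ?L"
    then obtain m b b' where e: "e = {Ln m b, Ln m b'}" "m < q" "m \<noteq> \<mu>"
      "{b, b'} \<in> edges (H2_par q)" by (elim CollectE exE conjE) (rule that)
    show "e \<in> ?LA \<union> ?LB"
    proof (cases "m = 0")
      case False
      hence "m \<in> Zmod q - {0} - U_set q \<alpha> 1"
        using e(2,3) unfolding U_set_1 Zmod_def by simp
      thus ?thesis using e(1,4) unfolding G2_par_def by blast
    qed (use e in blast)
  next
    fix e assume "e \<in> ?LA \<union> ?LB"
    then consider u v where "e = {Ln 0 u, Ln 0 v}" "{u, v} \<in> edges (H2_par q)"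
      | m u v where "e = {Ln m u, Ln m v}" "m < q" "m \<noteq> \<mu>" "{u, v} \<in> edges (H2_par q)"
      unfolding G2_par_def U_set_1 Zmod_def by (elim UnE CollectE exE conjE) auto
    thus "e \<in> ?L"
    proof cases
      case 1
      moreover have "0 < q" "0 \<noteq> \<mu>" using q_gt \<mu>_pos by auto
      ultimately show ?thesis by blast
    qed blast
  qed
  show ?thesis
    unfolding P L B_def amalgam_def graph.sel B_deleted_edges by (simp only: Un_ac)
qed

lemma PP_edge: "{Pt x y, Pt x' y'} \<in> edges B \<longleftrightarrow> x = x' \<and> x < q \<and> {y, y'} \<in> edges (E x)"
  unfolding B_edges by (auto simp: doubleton_eq_iff insert_commute)

lemma LL_edge:
  "{Ln m b, Ln m' b'} \<in> edges B \<longleftrightarrow> m = m' \<and> m < q \<and> m \<noteq> \<mu> \<and> {b, b'} \<in> edges (H2_par q)"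
  unfolding B_edges by (auto simp: doubleton_eq_iff insert_commute)

lemma PL_edge:
  "{Pt x y, Ln m b} \<in> edges B \<longleftrightarrow>
    x < q \<and> m < q \<and> b < q \<and> m \<noteq> \<mu> \<and> y = (m * x + b) mod q \<and> \<not> (x = 0 \<and> y \<in> {n, 3 * n + 1})"
  unfolding B_edges by (auto simp: doubleton_eq_iff)

lemma LP_edge:
  "{Ln m b, Pt x y} \<in> edges B \<longleftrightarrow>
    x < q \<and> m < q \<and> b < q \<and> m \<noteq> \<mu> \<and> y = (m * x + b) mod q \<and> \<not> (x = 0 \<and> y \<in> {n, 3 * n + 1})"
  using PL_edge by (simp add: insert_commute)

lemma E_edgeD:
  assumes "{y, y'} \<in> edges (E x)"
  shows "y < q" "y' < q" "y \<noteq> y'" "x = 0 \<Longrightarrow> y \<notin> {n, 3 * n + 1} \<and> y' \<notin> {n, 3 * n + 1}"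
  using assms n_ge
  by (auto simp: E_def G1_par_edge[OF q_eq] H1_par_edge[OF q_eq n_ge] half_step_def split: if_splits)

lemma H2_edgeD:
  assumes "{b, b'} \<in> edges (H2_par q)"
  shows "b < q" "b' < q" "b \<noteq> b'"
  using assms n_ge unfolding H2_par_edge[OF q_eq n_ge] unfolding q_eq by auto

lemma simple_B: "simple_graph B"
  unfolding simple_graph_def
proof (intro conjI ballI)
  show "finite (verts B)" unfolding B_verts by blast
next
  fix e assume e: "e \<in> edges B"
  then consider x y m b where "e = {Pt x y, Ln m b}" | x y y' where "e = {Pt x y, Pt x y'}"
    | m b b' where "e = {Ln m b, Ln m b'}"
    unfolding B_edges by blast
  hence "e \<subseteq> verts B \<and> card e = 2"
  proof cases
    case (1 x y m b)
    have "Pt x y \<in> verts B" "Ln m b \<in> verts B"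
      using e q_gt unfolding 1 PL_edge verts_iff by auto
    thus ?thesis by (simp add: 1)
  next
    case (2 x y y')
    have "Pt x y \<in> verts B" "Pt x y' \<in> verts B" "y \<noteq> y'"
      using e E_edgeD[of y y' x] unfolding 2 PP_edge verts_iff by auto
    thus ?thesis by (simp add: 2)
  next
    case (3 m b b')
    have "Ln m b \<in> verts B" "Ln m b' \<in> verts B" "b \<noteq> b'"
      using e H2_edgeD[of b b'] unfolding 3 LL_edge verts_iff by auto
    thus ?thesis by (simp add: 3)
  qed
  thus "e \<subseteq> verts B" "card e = 2" by auto
qed

text \<open>There are \<open>q * q - 2\<close> points, two being deleted from block 0, and
  \<open>(q - 1) * q\<close> lines, one block being deleted.\<close>

lemma order_B: "graph_order B = 2 * q ^ 2 - q - 2"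
proof -
  let ?P = "\<Union>x\<in>{..<q}. Pt x ` {..<q}" and ?L = "\<Union>m\<in>{..<q} - {\<mu>}. Ln m ` {..<q}"
  have "card ?P = (\<Sum>x<q. card (Pt x ` {..<q}))" by (rule card_UN_disjoint) auto
  also have "\<dots> = q * q" by (simp add: card_image inj_on_def)
  finally have "card ?P = q * q" .
  moreover have "n < q" "3 * n + 1 < q" using q_eq n_ge by auto
  hence "Pt 0 ` {n, 3 * n + 1} \<subseteq> Pt 0 ` {..<q}" by auto
  hence "Pt 0 ` {n, 3 * n + 1} \<subseteq> ?P"
    using UN_upper[of 0 "{..<q}" "\<lambda>x. Pt x ` {..<q}"] q_gt by (meson lessThan_iff order_trans
      less_trans zero_less_numeral)
  moreover have "card (Pt 0 ` {n, 3 * n + 1}) = 2" by simp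
  ultimately have P: "card (?P - Pt 0 ` {n, 3 * n + 1}) = q * q - 2"
    by (simp add: card_Diff_subset)
  have "card ?L = (\<Sum>m\<in>{..<q} - {\<mu>}. card (Ln m ` {..<q}))" by (rule card_UN_disjoint) auto
  also have "\<dots> = (q - 1) * q" using \<mu>_less by (simp add: card_image inj_on_def)
  finally have L: "card ?L = (q - 1) * q" .
  have "card (verts B) = (q * q - 2) + (q - 1) * q"
    unfolding B_verts P[symmetric] L[symmetric] by (rule card_Un_disjoint) auto
  moreover have "(q - 1) * q = q * q - q" by (simp add: diff_mult_distrib)
  moreover have "q \<le> q * q" by simp
  ultimately have "card (verts B) = 2 * (q * q) - q - 2" using q_gt by linarith
  thus ?thesis by (simp add: graph_order_def power2_eq_square)
qed

section \<open>Compatibility of block edges with incidence\<close>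

lemma H2_not_half_step:
  assumes "{b, b'} \<in> edges (H2_par q)"
  shows "\<not> half_step n b b'"
proof
  assume "half_step n b b'"
  \<comment> \<open>Edges at 0 avoid the differences \<open>2 * n\<close> and
    \<open>2 * n + 1\<close> by construction, and the two remaining edges have difference
    \<open>n\<close>.\<close>
  thus False
    using assms n_ge unfolding H2_par_edge[OF q_eq n_ge] unfolding half_step_def q_eq
    by (elim disjE conjE) simp_all
qed

text \<open>Half steps are already excluded, so only the extra edge of \<open>H1_par\<close> is
  left; it avoids 0 and is neither of the two edges of \<open>H2_par\<close> that avoid 0.\<close>

lemma H1_H2_edge_disjoint:
  assumes "{b, b'} \<in> edges (H1_par q)"
  shows "{b, b'} \<notin> edges (H2_par q)"
proof
  assume H2: "{b, b'} \<in> edges (H2_par q)"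
  hence "b = 3 * n \<and> b' = n + 1 \<or> b = n + 1 \<and> b' = 3 * n"
    using assms H2_not_half_step unfolding H1_par_edge[OF q_eq n_ge] by blast
  thus False
    using H2 n_ge unfolding H2_par_edge[OF q_eq n_ge] by auto
qed

text \<open>Excludes the 4-cycle made of two adjacent points and two adjacent lines.\<close>

lemma E_H2_edge_disjoint:
  assumes PP: "{Pt x y, Pt x y'} \<in> edges B" and PL: "{Pt x y, Ln m b} \<in> edges B"
    "{Pt x y', Ln m b'} \<in> edges B"
  shows "{Ln m b, Ln m b'} \<notin> edges B"
proof
  assume "{Ln m b, Ln m b'} \<in> edges B"
  hence H2: "{b, b'} \<in> edges (H2_par q)" unfolding LL_edge by blast
  have E: "{y, y'} \<in> edges (E x)" using PP unfolding PP_edge by blast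
  have y: "y = (m * x + b) mod q" "b < q" "y' = (m * x + b') mod q" "b' < q"
    using PL unfolding PL_edge by blast+
  show False
  proof (cases "x = 0")
    case True
    \<comment> \<open>For \<open>x = 0\<close> incidence reads \<open>y = b\<close>, so both block
      edges join the same two residues.\<close>
    thus False using E H2 H1_H2_edge_disjoint y by (simp add: E_def)
  next
    case False
    hence h: "half_step n y y'" using E by (simp add: E_def G1_par_edge[OF q_eq])
    \<comment> \<open>Eliminating \<open>m * x\<close> shows that both block edges have the same
      difference modulo \<open>q\<close>, written with sums to avoid truncated subtraction. The sums
      are below \<open>2 * q\<close>, so they are equal or differ by exactly
      \<open>q\<close>.\<close>
    have "(y + b') mod q = (m * x + b + b') mod q" unfolding y(1) by (rule mod_add_left_eq)
    also have "\<dots> = (m * x + b' + b) mod q" by (simp add: ac_simps)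
    also have "\<dots> = (y' + b) mod q" unfolding y(3) by (rule mod_add_left_eq[symmetric])
    finally have c: "(y + b') mod q = (y' + b) mod q" .
    have lt: "y < q" "y' < q" using E E_edgeD by blast+
    have m: "w mod q = (if w < q then w else w - q)" if "w < 2 * q" for w
      using that by (auto simp: mod_if)
    have "y + b' < 2 * q" "y' + b < 2 * q" using lt y(2,4) by auto
    from c[unfolded m[OF this(1)] m[OF this(2)]]
    have "y + b' = y' + b \<or> y + b' = y' + b + q \<or> y + b' + q = y' + b"
      by (auto split: if_splits)
    hence "half_step n b b'"
      using h y(2,4) lt unfolding half_step_def unfolding q_eq by (elim disjE) simp_all
    thus False using H2 H2_not_half_step by blast
  qed
qed

text \<open>For a fixed \<open>x\<close> the incidence equation determines \<open>y\<close>. With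
  the dual statement that follows, this excludes short cycles having exactly one vertex outside a
  block.\<close>

lemma PL_edge_unique_point:
  assumes "{Pt x y, Ln m b} \<in> edges B" "{Pt x y', Ln m b} \<in> edges B"
  shows "y = y'"
  using assms unfolding PL_edge by simp

lemma PL_edge_unique_line:
  assumes "{Pt x y, Ln m b} \<in> edges B" "{Pt x y, Ln m b'} \<in> edges B"
  shows "b = b'"
proof -
  have "[m * x + b = m * x + b'] (mod q)" "b < q" "b' < q"
    using assms unfolding PL_edge cong_def by auto
  thus ?thesis using cong_add_lcancel_nat cong_less_modulus_unique_nat by blast
qed

text \<open>Subtracting the incidence equations cancels the intercepts and leaves
  \<open>(m - m') * (x - x')\<close> divisible by the prime \<open>q\<close>. Hence the slopes or
  the abscissae agree, and uniqueness gives the rest. The subtraction is carried out in the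
  integers.\<close>

lemma PL_edges_quadrangle:
  assumes "{Pt x y, Ln m b} \<in> edges B" "{Pt x y, Ln m' b'} \<in> edges B"
    "{Pt x' y', Ln m b} \<in> edges B" "{Pt x' y', Ln m' b'} \<in> edges B"
  shows "Pt x y = Pt x' y' \<or> Ln m b = Ln m' b'"
proof -
  have lt: "x < q" "x' < q" "m < q" "m' < q" using assms unfolding PL_edge by blast+
  have "[m * x + b = m' * x + b'] (mod q)" "[m * x' + b = m' * x' + b'] (mod q)"
    using assms unfolding PL_edge cong_def by auto
  hence "int q dvd int (m * x + b) - int (m' * x + b')"
    "int q dvd int (m * x' + b) - int (m' * x' + b')"
    by (metis cong_iff_dvd_diff cong_int_iff)+
  hence "int q dvd (int (m * x + b) - int (m' * x + b')) - (int (m * x' + b) - int (m' * x' + b'))"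
    by (rule dvd_diff)
  also have "\<dots> = (int m - int m') * (int x - int x')" by (simp add: algebra_simps)
  finally have "int q dvd int m - int m' \<or> int q dvd int x - int x'"
    using prime_q by (simp add: prime_dvd_mult_iff)
  hence "m = m' \<or> x = x'" using int_dvd_diff_less_imp_eq lt by blast
  thus ?thesis using PL_edge_unique_point PL_edge_unique_line assms by blast
qed

lemma E_triangle_free:
  assumes "{a, b} \<in> edges (E x)" "{b, c} \<in> edges (E x)"
  shows "{c, a} \<notin> edges (E x)"
  using assms G1_par_triangle_free[OF q_eq n_ge, of a b c]
    H1_par_triangle_free[OF q_eq n_ge, of a b c]
  by (simp add: E_def split: if_splits)

lemma E_quadrangle_free:
  assumes "{a, b} \<in> edges (E x)" "{b, c} \<in> edges (E x)" "{c, d} \<in> edges (E x)"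
    "{d, a} \<in> edges (E x)"
  shows "a = c \<or> b = d"
  using assms G1_par_quadrangle_free[OF q_eq n_ge, of a b c d]
    H1_par_quadrangle_free[OF q_eq n_ge, of a b c d]
  by (simp add: E_def split: if_splits)

section \<open>Girth of the amalgam\<close>

lemma B_triangle_free:
  assumes e: "{u, v} \<in> edges B" "{v, w} \<in> edges B"
  shows "{w, u} \<notin> edges B"
proof
  assume e': "{w, u} \<in> edges B"
  have PPL: "\<not> ({Pt x y, Pt x' y'} \<in> edges B \<and> {Pt x y, Ln m b} \<in> edges B \<and> {Pt x' y', Ln m b} \<in> edges B)"
    for x y x' y' m b
    using PL_edge_unique_point E_edgeD(3) unfolding PP_edge by blast
  have PLL: "\<not> ({Ln m b, Ln m' b'} \<in> edges B \<and> {Pt x y, Ln m b} \<in> edges B \<and> {Pt x y, Ln m' b'} \<in> edges B)"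
    for x y m b m' b'
    using PL_edge_unique_line H2_edgeD(3) unfolding LL_edge by blast
  have sym: "{a, b} \<in> edges B \<Longrightarrow> {b, a} \<in> edges B" for a b by (simp add: insert_commute)
  have PPP: "\<not> ({Pt a b, Pt c d} \<in> edges B \<and> {Pt c d, Pt g f} \<in> edges B \<and> {Pt g f, Pt a b} \<in> edges B)"
    for a b c d g f
    using E_triangle_free[of b d a f] by (auto simp: PP_edge)
  have LLL: "\<not> ({Ln a b, Ln c d} \<in> edges B \<and> {Ln c d, Ln g f} \<in> edges B \<and> {Ln g f, Ln a b} \<in> edges B)"
    for a b c d g f
    using H2_par_triangle_free[OF q_eq n_ge, of b d f] by (auto simp: LL_edge)
  note e = e e'
  note e'' = e[THEN sym]
  show False
    by (insert e e'', (cases u; cases v; cases w; hypsubst))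
      (use PPP LLL PPL PLL in \<open>metis\<close>)+
qed

text \<open>Up to rotation and reflection, a closed walk of length four has six patterns of points
  and lines, each treated by one auxiliary fact. The final case split reduces all sixteen patterns
  to these.\<close>

lemma B_quadrangle_free:
  assumes e: "{u, v} \<in> edges B" "{v, w} \<in> edges B" "{w, z} \<in> edges B" "{z, u} \<in> edges B"
  shows "u = w \<or> v = z"
proof -
  define A where "A = (\<lambda>u v. {u, v} \<in> edges B)"
  have sym: "A b a" if "A a b" for a b using that by (simp add: A_def insert_commute)
  have PPPP: "Pt x1 y1 = Pt x3 y3 \<or> Pt x2 y2 = Pt x4 y4"
    if "A (Pt x1 y1) (Pt x2 y2)" "A (Pt x2 y2) (Pt x3 y3)" "A (Pt x3 y3) (Pt x4 y4)"
      "A (Pt x4 y4) (Pt x1 y1)" for x1 y1 x2 y2 x3 y3 x4 y4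
    using that E_quadrangle_free[of y1 y2 x1 y3 y4] unfolding A_def PP_edge by auto
  have LLLL: "Ln m1 b1 = Ln m3 b3 \<or> Ln m2 b2 = Ln m4 b4"
    if "A (Ln m1 b1) (Ln m2 b2)" "A (Ln m2 b2) (Ln m3 b3)" "A (Ln m3 b3) (Ln m4 b4)"
      "A (Ln m4 b4) (Ln m1 b1)" for m1 b1 m2 b2 m3 b3 m4 b4
    using that H2_par_quadrangle_free[OF q_eq n_ge, of b1 b2 b3 b4] unfolding A_def LL_edge by auto
  have PPPL: "Pt x1 y1 = Pt x3 y3"
    if "A (Pt x1 y1) (Pt x2 y2)" "A (Pt x2 y2) (Pt x3 y3)" "A (Pt x3 y3) (Ln m b)"
      "A (Ln m b) (Pt x1 y1)" for x1 y1 x2 y2 x3 y3 m b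
    using that(1,2) that(3) sym[OF that(4)] PL_edge_unique_point[of x1 y1 m b y3]
    unfolding A_def PP_edge by auto
  have LLLP: "Ln m1 b1 = Ln m3 b3"
    if "A (Ln m1 b1) (Ln m2 b2)" "A (Ln m2 b2) (Ln m3 b3)" "A (Ln m3 b3) (Pt x y)"
      "A (Pt x y) (Ln m1 b1)" for m1 b1 m2 b2 m3 b3 x y
    using that(1,2,4) sym[OF that(3)] PL_edge_unique_line[of x y m1 b1 b3]
    unfolding A_def LL_edge by auto
  have PPLL: False
    if "A (Pt x1 y1) (Pt x2 y2)" "A (Pt x2 y2) (Ln m2 b2)" "A (Ln m2 b2) (Ln m1 b1)"
      "A (Ln m1 b1) (Pt x1 y1)" for x1 y1 x2 y2 m1 b1 m2 b2
  proof -
    have "x1 = x2" "m1 = m2" using that(1,3) unfolding A_def PP_edge LL_edge by auto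
    thus False
      using E_H2_edge_disjoint[of x1 y1 y2 m1 b1 b2] that(1,2) sym[OF that(3)] sym[OF that(4)]
      unfolding A_def by blast
  qed
  have PLPL: "Pt x1 y1 = Pt x2 y2 \<or> Ln m1 b1 = Ln m2 b2"
    if "A (Pt x1 y1) (Ln m1 b1)" "A (Ln m1 b1) (Pt x2 y2)" "A (Pt x2 y2) (Ln m2 b2)"
      "A (Ln m2 b2) (Pt x1 y1)" for x1 y1 x2 y2 m1 b1 m2 b2
    using PL_edges_quadrangle[of x1 y1 m1 b1 m2 b2 x2 y2] that(1,3) sym[OF that(2)] sym[OF that(4)]
    unfolding A_def by blast
  have e: "A u v" "A v w" "A w z" "A z u" using assms by (simp_all add: A_def)
  note e' = e[THEN sym]
  show ?thesis
    by (cases u; cases v; cases w; cases z; hypsubst)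
      (use e e' PPPP LLLL PPPL LLLP PPLL PLPL in \<open>metis\<close>)+
qed

lemma girth_B: "girth B = enat 5"
proof (rule antisym)
  show "enat 5 \<le> girth B"
    unfolding girth_ge_5_iff[OF simple_B] using B_triangle_free B_quadrangle_free by blast
  \<comment> \<open>Two half steps in point block 1 lead from 0 to 1. The horizontal lines through
    the ends have intercepts 0 and 1, which are adjacent in \<open>H2_par\<close>.\<close>
  let ?c = "[Pt 1 0, Pt 1 (2 * n + 1), Pt 1 1, Ln 0 1, Ln 0 0]"
  have G1: "{0, 2 * n + 1} \<in> edges (G1_par q)" "{2 * n + 1, 1} \<in> edges (G1_par q)"
    unfolding G1_par_edge[OF q_eq] half_step_def using q_eq n_ge by auto
  have H2: "{1, 0} \<in> edges (H2_par q)"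
    unfolding H2_par_edge[OF q_eq n_ge] using q_gt n_ge by simp
  have "{Pt 1 0, Pt 1 (2 * n + 1)} \<in> edges B" "{Pt 1 (2 * n + 1), Pt 1 1} \<in> edges B"
    "{Pt 1 1, Ln 0 1} \<in> edges B" "{Ln 0 1, Ln 0 0} \<in> edges B" "{Ln 0 0, Pt 1 0} \<in> edges B"
    using G1 H2 q_gt \<mu>_pos by (simp_all add: PP_edge LL_edge PL_edge LP_edge E_def)
  moreover have "2 * n + 1 < q" using q_eq n_ge by simp
  hence "set ?c \<subseteq> verts B" using q_gt \<mu>_pos by (simp add: verts_iff)
  ultimately have "is_cycle B ?c"
    using n_ge unfolding is_cycle_def by (simp add: All_less_Suc)
  hence "girth B \<le> enat (length ?c)" unfolding girth_def by (intro Inf_lower) blast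
  thus "girth B \<le> enat 5" by (simp add: numeral_eq_Suc)
qed

section \<open>Degrees in the amalgam\<close>

lemma degree_Pt:
  assumes "Pt x y \<in> verts B"
  shows "graph_degree B (Pt x y) = q + 1"
proof -
  \<comment> \<open>\<open>?f m\<close> is the intercept \<open>y - m * x\<close> of the line of
    slope \<open>m\<close> through the point, with \<open>q - x\<close> standing for
    \<open>- x\<close>. The \<open>q - 1\<close> remaining slopes and two block neighbours give
    degree \<open>q + 1\<close>.\<close>
  let ?f = "\<lambda>m. (y + m * (q - x)) mod q" and ?E = "{y'. {y, y'} \<in> edges (E x)}"
  have xy: "x < q" "y < q" "\<not> (x = 0 \<and> y \<in> {n, 3 * n + 1})"
    using assms by (simp_all add: verts_iff)
  have s: "m * x + m * (q - x) = m * q" for m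
    using xy by (metis add_mult_distrib2 le_add_diff_inverse less_imp_le)
  have f: "b < q \<and> y = (m * x + b) mod q \<longleftrightarrow> b = ?f m" for m b
  proof
    assume b: "b < q \<and> y = (m * x + b) mod q"
    hence "?f m = (m * x + b + m * (q - x)) mod q" by (simp add: mod_add_left_eq)
    also have "m * x + b + m * (q - x) = b + m * q" using s by (simp add: ac_simps)
    finally show "b = ?f m" using b by simp
  next
    assume b: "b = ?f m"
    have "(m * x + b) mod q = (m * x + (y + m * (q - x))) mod q" unfolding b by (rule mod_add_right_eq)
    also have "m * x + (y + m * (q - x)) = y + m * q" using s by (simp add: ac_simps)
    finally show "b < q \<and> y = (m * x + b) mod q" using b xy by simp
  qed
  have "{u. {Pt x y, u} \<in> edges B} = Pt x ` ?E \<union> (\<lambda>m. Ln m (?f m)) ` ({..<q} - {\<mu>})"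
  proof (rule Set.set_eqI)
    fix u
    show "u \<in> {u. {Pt x y, u} \<in> edges B} \<longleftrightarrow>
      u \<in> Pt x ` ?E \<union> (\<lambda>m. Ln m (?f m)) ` ({..<q} - {\<mu>})"
    proof (cases u)
      case (Pt x' y')
      thus ?thesis using xy by (auto simp: PP_edge)
    next
      case (Ln m b)
      thus ?thesis using xy f[of b m] by (auto simp: PL_edge)
    qed
  qed
  moreover have "card (Pt x ` ?E) = 2"
  proof -
    have "card ?E = 2"
      using card_G1_par_neighbours[OF q_eq n_ge] card_H1_par_neighbours[OF q_eq n_ge] xy
      by (cases "x = 0") (auto simp: E_def)
    thus ?thesis by (simp add: card_image inj_on_def)
  qed
  moreover have "card ((\<lambda>m. Ln m (?f m)) ` ({..<q} - {\<mu>})) = q - 1"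
    using \<mu>_less by (simp add: card_image inj_on_def)
  moreover have "finite (Pt x ` ?E)"
    by (rule finite_imageI, rule finite_subset[of _ "{..<q}"]) (auto dest: E_edgeD)
  moreover have "Pt x ` ?E \<inter> (\<lambda>m. Ln m (?f m)) ` ({..<q} - {\<mu>}) = {}" by blast
  ultimately show ?thesis
    using q_gt by (simp add: degree_eq_card_neighbours[OF simple_B] card_Un_disjoint)
qed

text \<open>The lines with intercept \<open>n\<close> or \<open>3 * n + 1\<close> lose their point
  in block 0, and the second neighbour of these residues in \<open>H2_par\<close> makes up for it.
  Intercept 0 has \<open>q - 3\<close> block neighbours and \<open>q\<close> points.\<close>

lemma degree_Ln:
  assumes "Ln m b \<in> verts B"
  shows "graph_degree B (Ln m b) = (if b = 0 then 2 * q - 3 else q + 1)"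
proof -
  let ?H = "{b'. {b, b'} \<in> edges (H2_par q)}" and ?f = "\<lambda>x. Pt x ((m * x + b) mod q)"
  \<comment> \<open>\<open>X\<close> collects the abscissae of the surviving points on the line; at
    abscissa 0 the point has ordinate \<open>b\<close>.\<close>
  define X where "X = (if b \<in> {n, 3 * n + 1} then {..<q} - {0} else {..<q})"
  have mb: "m < q" "b < q" "m \<noteq> \<mu>" using assms by (simp_all add: verts_iff)
  have X: "x \<in> X \<longleftrightarrow> x < q \<and> \<not> (x = 0 \<and> (m * x + b) mod q \<in> {n, 3 * n + 1})" for x
    using mb by (cases "x = 0") (auto simp: X_def)
  have "{u. {Ln m b, u} \<in> edges B} = Ln m ` ?H \<union> ?f ` X"
  proof (rule Set.set_eqI)
    fix u
    show "u \<in> {u. {Ln m b, u} \<in> edges B} \<longleftrightarrow> u \<in> Ln m ` ?H \<union> ?f ` X"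
    proof (cases u)
      case (Pt x' y')
      thus ?thesis using mb X[of x'] by (auto simp: LP_edge)
    next
      case (Ln m' b')
      thus ?thesis using mb by (auto simp: LL_edge)
    qed
  qed
  moreover have "card (Ln m ` ?H) = card ?H" by (simp add: card_image inj_on_def)
  moreover have "card (?f ` X) = card X" by (simp add: card_image inj_on_def)
  moreover have "finite (Ln m ` ?H)"
    by (rule finite_imageI, rule finite_subset[of _ "{..<q}"]) (auto dest: H2_edgeD)
  moreover have "finite (?f ` X)" by (simp add: X_def)
  moreover have "Ln m ` ?H \<inter> ?f ` X = {}" by blast
  ultimately have "graph_degree B (Ln m b) = card ?H + card X"
    by (simp add: degree_eq_card_neighbours[OF simple_B] card_Un_disjoint)
  moreover have "card X = (if b \<in> {n, 3 * n + 1} then q - 1 else q)"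
    using q_gt by (simp add: X_def)
  ultimately show ?thesis
    using card_H2_par_neighbours[OF q_eq n_ge mb(2)] q_gt n_ge by auto
qed

lemma degrees_B: "graph_degree B ` verts B = {q + 1, 2 * q - 3}"
proof
  show "graph_degree B ` verts B \<subseteq> {q + 1, 2 * q - 3}"
  proof (rule image_subsetI)
    fix v assume "v \<in> verts B"
    thus "graph_degree B v \<in> {q + 1, 2 * q - 3}"
      by (cases v) (auto simp: degree_Pt degree_Ln)
  qed
  have "Ln 0 0 \<in> verts B" "Ln 0 1 \<in> verts B" using q_gt \<mu>_pos by (simp_all add: verts_iff)
  hence "graph_degree B (Ln 0 1) = q + 1" "graph_degree B (Ln 0 0) = 2 * q - 3"
    by (simp_all add: degree_Ln)
  thus "{q + 1, 2 * q - 3} \<subseteq> graph_degree B ` verts B"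
    using \<open>Ln 0 0 \<in> verts B\<close> \<open>Ln 0 1 \<in> verts B\<close> by (metis empty_subsetI image_eqI insert_subset)
qed

section \<open>Order and minimality\<close>

lemma cage_B:
  "biregular_cage (q + 1) (2 * (q + 1) - 5) 5 B"
  "graph_order B = (q + 1) * (2 * (q + 1) - 5) + 1"
proof -
  show order: "graph_order B = (q + 1) * (2 * (q + 1) - 5) + 1"
  proof -
    \<comment> \<open>Writing \<open>q\<close> as \<open>k + 3\<close> turns the truncated
      difference \<open>2 * (q + 1) - 5\<close> into \<open>2 * k + 3\<close>.\<close>
    have "2 * (k + 3) ^ 2 - (k + 3) - 2 = (k + 3 + 1) * (2 * (k + 3 + 1) - 5) + 1" for k :: nat
    proof -
      have *: "2 * (k + 3 + 1) - 5 = 2 * k + 3" by simp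
      have "2 * (k + 3) ^ 2 = (k + 3 + 1) * (2 * k + 3) + 1 + (k + 3) + 2"
        by (simp add: power2_eq_square algebra_simps)
      thus ?thesis unfolding * by simp
    qed
    from this[of "q - 3"] show ?thesis using q_gt by (simp add: order_B)
  qed
  have "biregular_graph (q + 1) (2 * (q + 1) - 5) 5 B"
    using simple_B girth_B degrees_B q_gt by (simp add: biregular_graph_def)
  thus "biregular_cage (q + 1) (2 * (q + 1) - 5) 5 B"
    using biregular_order_lower_bound order unfolding biregular_cage_def by fastforce
qed

end

theorem theorem5p2:
  fixes n q r \<alpha> :: nat
  assumes "q = 4 * n + 1" and "prime q" and "n \<ge> 3" and "r = q + 1"
    and "\<alpha> \<in> Zmod q" and "residue_primroot q \<alpha>"
  defines "Bstar \<equiv> amalgam q \<alpha> (S_par q) {} 0 1 (H1_par q) (H2_par q) (G1_par q) (G2_par q)"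
  shows "biregular_cage r (2 * r - 5) 5 Bstar \<and> graph_order Bstar = r * (2 * r - 5) + 1"
proof -
  interpret amalgam_parameters n q \<alpha>
    using assms by unfold_locales (auto simp: residue_primroot_def)
  show ?thesis using cage_B unfolding Bstar_def B_def assms(4) by blast
qed

end
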